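(* Let $q\in\mathbb{C}^*$ with $0<|q|<1$. For any $x\in\mathbb{C}^*$, \[ \operatorname{A}_{q^2}\left(-\frac{q^3}{x^2}\right)=\frac{1}{(q,-1;q)_\infty}\left\{\theta\left(\frac{x}{q}\right)\operatorname{Ai}_q(-x)+\theta\left(-\frac{x}{q}\right)\operatorname{Ai}_q(x)\right\}, \] where $\operatorname{A}_{q^2}$ is the Ramanujan function with base $q^2$, $\operatorname{Ai}_q$ is the $q$-Airy function with base $q$, and $\theta=\theta_q$ is the theta function of Jacobi with base $q$.
   Context: Here $\mathbb{C}^*=\mathbb{C}\setminus\{0\}$. The $q$-Pochhammer symbol, for a base $p\in\mathbb{C}^*$ with $0<|p|<1$ and $a\in\mathbb{C}$, is $(a;p)_0=1$, $(a;p)_n=(1-a)(1-ap)\cdots(1-ap^{n-1})$ for $n\ge 1$, and $(a;p)_\infty=\lim_{n\to\infty}(a;p)_n$. For several parameters, $(a_1,\dots,a_m;p)_n=(a_1;p)_n\cdots(a_m;p)_n$ and $(a_1,\dots,a_m;p)_\infty=(a_1;p)_\infty\cdots(a_m;p)_\infty$. The Ramanujan function with base $p$ is the (everywhere convergent) series \[ \operatorname{A}_p(x)=\sum_{n\ge 0}\frac{p^{n^2}}{(p;p)_n}(-x)^n ; \] thus $\operatorname{A}_{q^2}(x)=\sum_{n\ge 0}\frac{q^{2n^2}}{(q^2;q^2)_n}(-x)^n$. The $q$-Airy function is the (everywhere convergent) series \[ \operatorname{Ai}_q(x)=\sum_{n\ge 0}\frac{1}{(-q,q;q)_n}\left\{(-1)^nq^{\frac{n(n-1)}{2}}\right\}(-x)^n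 . \] The theta function of Jacobi with base $q$ is, for $x\in\mathbb{C}^*$, \[ \theta(x)=\theta_q(x)=\sum_{n\in\mathbb{Z}}q^{\frac{n(n-1)}{2}}x^n . \] *)

theory Defs
  imports "HOL-Analysis.Analysis"
begin

definition qpoch :: "complex \<Rightarrow> complex \<Rightarrow> nat \<Rightarrow> complex" where
  "qpoch a p n = (\<Prod>k<n. 1 - a * p ^ k)"

definition qpoch_inf :: "complex \<Rightarrow> complex \<Rightarrow> complex" where
  "qpoch_inf a p = lim (\<lambda>n. qpoch a p n)"

definition ramanujan_A :: "complex \<Rightarrow> complex \<Rightarrow> complex" where
  "ramanujan_A p x = (\<Sum>n. p ^ (n ^ 2) / qpoch p p n * (- x) ^ n)"

definition q_Airy :: "complex \<Rightarrow> complex \<Rightarrow> complex" where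
  "q_Airy q x =
     (\<Sum>n. 1 / (qpoch (- q) q n * qpoch q q n) *
          ((- 1) ^ n * q ^ (n * (n - 1) div 2)) * (- x) ^ n)"

text \<open>The two-sided series is an unordered sum over all integers; the exponent
  \<open>n * (n - 1) div 2\<close> is an exact, non-negative integer division for every integer \<open>n\<close>.\<close>

definition jacobi_theta :: "complex \<Rightarrow> complex \<Rightarrow> complex" where
  "jacobi_theta q x = (\<Sum>\<^sub>\<infinity>n::int. q powi (n * (n - 1) div 2) * x powi n)"

end

theory Submission
  imports Defs
begin

text \<open>
  Write \<open>p = q\<^sup>2\<close>. Since \<open>(-q, q; q)\<^sub>n = (p; p)\<^sub>n\<close>, the product of the series for
  \<open>\<theta>(y/q)\<close> and \<open>Ai\<^sub>q(-y)\<close> is a double series in powers of \<open>y\<close>. It converges absolutely, so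
  its terms may be grouped by the total power \<open>y\<^sup>k\<close>, with \<open>k\<close> an integer. In the group of \<open>y\<^sup>k\<close>
  the quadratic exponents of \<open>q\<close> from both factors combine so that what remains is Euler's series
  for \<open>(q\<^bsup>2-k\<^esup>; p)\<^sub>\<infinity>\<close>; this is \<open>theta_times_Airy\<close>.

  Adding the expansions for \<open>y = x\<close> and \<open>y = -x\<close> cancels the odd \<open>k\<close> and doubles the even ones.
  For \<open>k = 2j\<close> with \<open>j > 0\<close> the product \<open>(p\<^bsup>1-j\<^esup>; p)\<^sub>\<infinity>\<close> contains a zero factor, which makes the
  two-sided series one-sided. For \<open>k = -2m\<close> with \<open>m \<ge> 0\<close> it equals
  \<open>(p\<^bsup>m+1\<^esup>; p)\<^sub>\<infinity> = (p; p)\<^sub>\<infinity> / (p; p)\<^sub>m\<close>, which produces exactly the coefficients of the Ramanujan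
  function, up to the factor \<open>2 (p; p)\<^sub>\<infinity> = (q, -1; q)\<^sub>\<infinity>\<close> (\<open>qpoch_inf_q_minus_one\<close>).

  Euler's series \<open>f(z)\<close> itself is summed by its functional equation \<open>f(z) = (1 - z) f(pz)\<close>:
  iterating it peels off the factors of \<open>(z; p)\<^sub>n\<close>, and \<open>f(p\<^sup>n z)\<close> tends to \<open>f(0) = 1\<close>.
\<close>

section \<open>Finite and infinite q-Pochhammer symbols\<close>

lemma qpoch_0 [simp]: "qpoch a p 0 = 1"
  by (simp add: qpoch_def)

lemma qpoch_Suc: "qpoch a p (Suc n) = qpoch a p n * (1 - a * p ^ n)"
  by (simp add: qpoch_def)

lemma qpoch_Suc_left: "qpoch a p (Suc n) = (1 - a) * qpoch (a * p) p n"
  unfolding qpoch_def by (subst prod.lessThan_Suc_shift) (simp add: mult.assoc)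

lemma qpoch_add: "qpoch a p (m + n) = qpoch a p m * qpoch (a * p ^ m) p n"
  by (induction n) (simp_all add: qpoch_Suc power_add mult_ac)

lemma qpoch_minus_mult: "qpoch (- q) q n * qpoch q q n = qpoch (q\<^sup>2) (q\<^sup>2) n"
  unfolding qpoch_def prod.distrib [symmetric]
  by (intro prod.cong refl) (simp add: algebra_simps power2_eq_square power_mult_distrib)

lemma one_minus_power_nonzero:
  fixes p :: complex
  assumes "norm p < 1"
  shows "1 - p ^ Suc n \<noteq> 0"
proof
  assume "1 - p ^ Suc n = 0"
  hence "norm p ^ Suc n = 1"
    by (metis eq_iff_diff_eq_0 norm_one norm_power)
  moreover have "norm p ^ Suc n < 1"
    using assms by (simp add: power_less_one_iff del: power_Suc)
  ultimately show False by simp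
qed

lemma qpoch_self_nonzero:
  assumes "norm p < 1"
  shows "qpoch p p n \<noteq> 0"
  using one_minus_power_nonzero[OF assms] by (auto simp: qpoch_def)

lemma qpoch_inf_eqI: "qpoch a p \<longlonglongrightarrow> L \<Longrightarrow> qpoch_inf a p = L"
  unfolding qpoch_inf_def by (rule limI)

lemma qpoch_inf_self_nonzero:
  assumes "norm p < 1"
  shows "qpoch_inf p p \<noteq> 0"
proof -
  have "summable (\<lambda>k. norm ((1 - p * p ^ k) - 1))"
    using assms by (simp add: norm_mult norm_power summable_geometric summable_mult)
  hence "convergent_prod (\<lambda>k. 1 - p * p ^ k)"
    by (intro abs_convergent_prod_imp_convergent_prod summable_imp_abs_convergent_prod)
  then obtain L where L: "(\<lambda>n. \<Prod>k\<le>n. 1 - p * p ^ k) \<longlonglongrightarrow> L" "L \<noteq> 0"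
    using convergent_prod_iff_nz_lim[of "\<lambda>k. 1 - p * p ^ k"]
      one_minus_power_nonzero[OF assms] by auto
  from L(1) have "(\<lambda>n. qpoch p p (Suc n)) \<longlonglongrightarrow> L"
    by (simp only: qpoch_def lessThan_Suc_atMost)
  hence "qpoch p p \<longlonglongrightarrow> L"
    by (simp only: filterlim_sequentially_Suc)
  with L(2) show ?thesis by (simp add: qpoch_inf_eqI)
qed


section \<open>Euler's series\<close>

text \<open>The form of the ratio test that fits series with quadratic exponents, whose successive quotients
  decay geometrically.\<close>

lemma summable_norm_if_ratio_tendsto_0:
  fixes c r :: "nat \<Rightarrow> complex"
  assumes "r \<longlonglongrightarrow> 0" and "\<And>n. c (Suc n) = r n * c n"
  shows "summable (\<lambda>n. norm (c n))"
proof -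
  have "eventually (\<lambda>n. norm (r n) < 1 / 2) sequentially"
    using assms(1) by (metis half_gt_zero_iff order_tendstoD(2) tendsto_norm_zero zero_less_one)
  then obtain N where N: "\<And>n. n \<ge> N \<Longrightarrow> norm (r n) < 1 / 2"
    by (auto simp: eventually_sequentially)
  show ?thesis
  proof (rule summable_ratio_test[where c = "1 / 2" and N = N])
    fix n assume "n \<ge> N"
    hence "norm (r n) * norm (c n) \<le> 1 / 2 * norm (c n)"
      using N[of n] by (intro mult_right_mono) auto
    thus "norm (norm (c (Suc n))) \<le> 1 / 2 * norm (norm (c n))"
      by (simp add: assms(2) norm_mult)
  qed simp
qed

lemma triangular_Suc: "Suc n * (Suc n - 1) div 2 = n * (n - 1) div 2 + n"
proof -
  have "Suc n * (Suc n - 1) = n * (n - 1) + n * 2"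
    by (cases n) (simp_all add: algebra_simps)
  thus ?thesis by simp
qed

text \<open>The base \<open>b\<close> of the quadratic exponent is kept apart from the base \<open>p\<close> of the denominator:
  \<open>b = p\<close> gives Euler's series, \<open>b = q\<close> and \<open>p = q\<^sup>2\<close> the q-Airy function, and \<open>p = 0\<close>, where the
  denominator is the constant \<open>(0; 0)\<^sub>n = 1\<close>, each half of the theta series.\<close>

lemma summable_norm_Euler:
  assumes "norm p < 1" and "norm b < 1"
  shows "summable (\<lambda>n. norm (b ^ (n * (n - 1) div 2) / qpoch p p n * z ^ n))"
proof (rule summable_norm_if_ratio_tendsto_0)
  have "(\<lambda>n. b ^ n / (1 - p * p ^ n) * z) \<longlonglongrightarrow> 0 / (1 - p * 0) * z"
    using assms by (intro tendsto_intros LIMSEQ_power_zero) auto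
  thus "(\<lambda>n. b ^ n / (1 - p * p ^ n) * z) \<longlonglongrightarrow> 0"
    by simp
  fix n show "b ^ (Suc n * (Suc n - 1) div 2) / qpoch p p (Suc n) * z ^ Suc n =
      b ^ n / (1 - p * p ^ n) * z * (b ^ (n * (n - 1) div 2) / qpoch p p n * z ^ n)"
    unfolding triangular_Suc qpoch_Suc by (simp add: power_add mult_ac)
qed

text \<open>Euler's identity. The sum \<open>f\<close> of the series satisfies \<open>f(w) = (1 - w) f(wp)\<close>, hence
  \<open>f(z) = (z; p)\<^sub>n f(z p\<^sup>n)\<close>, and \<open>f\<close> is continuous at \<open>0\<close> with \<open>f(0) = 1\<close>. The argument also
  yields the convergence of the infinite product.\<close>

lemma Euler_qpoch_inf:
  fixes p z :: complex
  assumes p: "norm p < 1"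
  shows "qpoch z p \<longlonglongrightarrow> qpoch_inf z p"
    and "(\<lambda>n. p ^ (n * (n - 1) div 2) / qpoch p p n * (- z) ^ n) sums qpoch_inf z p"
proof -
  define c where "c n = p ^ (n * (n - 1) div 2) / qpoch p p n * (- 1) ^ n" for n
  define f where "f w = (\<Sum>n. c n * w ^ n)" for w
  have c_eq: "c n * w ^ n = p ^ (n * (n - 1) div 2) / qpoch p p n * (- w) ^ n" for n w
    by (simp add: c_def power_minus[of w])
  have summ: "summable (\<lambda>n. c n * w ^ n)" for w
    unfolding c_eq by (rule summable_norm_cancel[OF summable_norm_Euler[OF p p]])
  \<comment> \<open>This recurrence is the functional equation of \<open>f\<close>, read off coefficientwise.\<close>
  have c_Suc: "c (Suc n) * (1 - p ^ Suc n) = - (p ^ n * c n)" for n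
    using one_minus_power_nonzero[OF p, of n]
    unfolding c_def triangular_Suc qpoch_Suc by (simp add: power_add)
  have f_step: "f w = (1 - w) * f (w * p)" for w
  proof -
    have "(\<lambda>n. c n * w ^ n - c n * (w * p) ^ n) sums (f w - f (w * p))"
      unfolding f_def by (intro sums_diff summable_sums summ)
    moreover have "(\<lambda>n. c n * w ^ n - c n * (w * p) ^ n) sums (- w * f (w * p))"
    proof -
      have "(\<lambda>n. - w * (c n * (w * p) ^ n)) sums (- w * f (w * p))"
        unfolding f_def by (intro sums_mult summable_sums summ)
      moreover have "- w * (c n * (w * p) ^ n) =
          c (Suc n) * w ^ Suc n - c (Suc n) * (w * p) ^ Suc n" for n
      proof -
        have "c (Suc n) * w ^ Suc n - c (Suc n) * (w * p) ^ Suc n =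
            (c (Suc n) * (1 - p ^ Suc n)) * w ^ Suc n"
          by (simp add: power_mult_distrib algebra_simps)
        thus ?thesis unfolding c_Suc by (simp add: power_mult_distrib)
      qed
      ultimately have "(\<lambda>n. c (Suc n) * w ^ Suc n - c (Suc n) * (w * p) ^ Suc n)
          sums (- w * f (w * p))"
        by simp
      thus ?thesis by (subst (asm) sums_Suc_iff) simp
    qed
    ultimately have "f w - f (w * p) = - w * f (w * p)"
      by (rule sums_unique2)
    thus ?thesis by (simp add: algebra_simps)
  qed
  have f_iter: "f z = qpoch z p n * f (z * p ^ n)" for n
  proof (induction n)
    case (Suc n)
    thus ?case using f_step[of "z * p ^ n"] by (simp add: qpoch_Suc mult_ac)
  qed simp
  have "isCont f 0"
    unfolding f_def by (rule isCont_powser_converges_everywhere[OF summ])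
  moreover have "(\<lambda>n. z * p ^ n) \<longlonglongrightarrow> z * 0"
    using p by (intro tendsto_intros LIMSEQ_power_zero) auto
  ultimately have lim1: "(\<lambda>n. f (z * p ^ n)) \<longlonglongrightarrow> f 0"
    using isCont_tendsto_compose[of 0 f] by simp
  have f0: "f 0 = 1"
    unfolding f_def by (subst powser_zero) (simp add: c_def)
  have "(\<lambda>n. f z / f (z * p ^ n)) \<longlonglongrightarrow> f z / 1"
    using lim1 f0 by (intro tendsto_intros) auto
  \<comment> \<open>Division by \<open>f (z * p ^ n)\<close> is possible only eventually: \<open>f\<close> does have zeros.\<close>
  moreover have "eventually (\<lambda>n. f (z * p ^ n) \<noteq> 0) sequentially"
    using lim1 f0 by (intro tendsto_imp_eventually_ne[of _ 1]) auto
  hence "eventually (\<lambda>n. f z / f (z * p ^ n) = qpoch z p n) sequentially"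
    by eventually_elim (metis f_iter nonzero_mult_div_cancel_right)
  ultimately have lim: "qpoch z p \<longlonglongrightarrow> f z"
    by (simp add: Lim_transform_eventually)
  hence eq: "qpoch_inf z p = f z"
    by (rule qpoch_inf_eqI)
  show "qpoch z p \<longlonglongrightarrow> qpoch_inf z p"
    using lim eq by simp
  show "(\<lambda>n. p ^ (n * (n - 1) div 2) / qpoch p p n * (- z) ^ n) sums qpoch_inf z p"
    unfolding eq f_def c_eq [symmetric] by (rule summable_sums[OF summ])
qed

lemma qpoch_inf_power_Suc:
  assumes p: "norm p < 1"
  shows "qpoch_inf (p ^ Suc m) p = qpoch_inf p p / qpoch p p m"
proof (rule qpoch_inf_eqI)
  have "(\<lambda>n. qpoch p p (n + m)) \<longlonglongrightarrow> qpoch_inf p p"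
    using Euler_qpoch_inf(1)[OF p] by (rule LIMSEQ_ignore_initial_segment)
  hence "(\<lambda>n. qpoch p p (n + m) / qpoch p p m) \<longlonglongrightarrow> qpoch_inf p p / qpoch p p m"
    using qpoch_self_nonzero[OF p] by (intro tendsto_intros)
  moreover have "qpoch p p (n + m) / qpoch p p m = qpoch (p ^ Suc m) p n" for n
    using qpoch_self_nonzero[OF p, of m] by (simp add: add.commute[of n] qpoch_add)
  ultimately show "qpoch (p ^ Suc m) p \<longlonglongrightarrow> qpoch_inf p p / qpoch p p m"
    by simp
qed

lemma qpoch_inf_eq_0:
  assumes "z * p ^ j = 1"
  shows "qpoch_inf z p = 0"
proof (rule qpoch_inf_eqI)
  have "qpoch z p n = 0" if "n > j" for n
    using that assms by (force simp: qpoch_def)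
  hence "eventually (\<lambda>n. qpoch z p n = 0) sequentially"
    by (intro eventually_sequentiallyI[of "Suc j"]) simp
  thus "qpoch z p \<longlonglongrightarrow> 0"
    by (rule tendsto_eventually)
qed

text \<open>\<open>(-1; q)\<^bsub>n+1\<^esub> = 2 (-q; q)\<^sub>n\<close>, and \<open>(q; q)\<^sub>n (-q; q)\<^sub>n = (q\<^sup>2; q\<^sup>2)\<^sub>n\<close>; the index shift is harmless
  in the limit.\<close>

lemma qpoch_inf_q_minus_one:
  assumes q: "norm q < 1"
  shows "qpoch_inf q q * qpoch_inf (- 1) q = 2 * qpoch_inf (q\<^sup>2) (q\<^sup>2)"
proof -
  have q2: "norm (q\<^sup>2) < 1"
    using q by (simp add: norm_power power_less_one_iff)
  have "(\<lambda>n. qpoch q q n * qpoch (- 1) q (Suc n)) \<longlonglongrightarrow> qpoch_inf q q * qpoch_inf (- 1) q"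
    using Euler_qpoch_inf(1)[OF q] by (intro tendsto_mult) (simp_all only: filterlim_sequentially_Suc)
  moreover have "qpoch q q n * qpoch (- 1) q (Suc n) = 2 * qpoch (q\<^sup>2) (q\<^sup>2) n" for n
    by (simp add: qpoch_Suc_left flip: qpoch_minus_mult)
  ultimately have "(\<lambda>n. 2 * qpoch (q\<^sup>2) (q\<^sup>2) n) \<longlonglongrightarrow> qpoch_inf q q * qpoch_inf (- 1) q"
    by simp
  moreover have "(\<lambda>n. 2 * qpoch (q\<^sup>2) (q\<^sup>2) n) \<longlonglongrightarrow> 2 * qpoch_inf (q\<^sup>2) (q\<^sup>2)"
    by (intro tendsto_intros Euler_qpoch_inf(1)[OF q2])
  ultimately show ?thesis by (rule LIMSEQ_unique)
qed


section \<open>The product of a theta function and a q-Airy function\<close>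

lemma has_sum_product_abs:
  fixes f :: "'a \<Rightarrow> complex" and g :: "'b \<Rightarrow> complex"
  assumes f: "(\<lambda>a. norm (f a)) summable_on A" and g: "(\<lambda>b. norm (g b)) summable_on B"
  shows "((\<lambda>(a, b). f a * g b) has_sum (infsum f A * infsum g B)) (A \<times> B)"
proof -
  have "(\<lambda>ab. norm (case ab of (a, b) \<Rightarrow> f a * g b)) summable_on (A \<times> B)"
    unfolding Infinite_Sum.abs_summable_on_Sigma_iff
    using f g by (auto simp: norm_mult infsum_cmult_right' abs_mult infsum_nonneg
        intro!: summable_on_cmult_left summable_on_cmult_right)
  hence "(\<lambda>(a, b). f a * g b) summable_on (A \<times> B)"
    by (rule abs_summable_summable)
  hence S: "((\<lambda>(a, b). f a * g b) has_sum infsum (\<lambda>(a, b). f a * g b) (A \<times> B)) (A \<times> B)"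
    by (rule has_sum_infsum)
  have "((\<lambda>a. f a * infsum g B) has_sum infsum (\<lambda>(a, b). f a * g b) (A \<times> B)) A"
    by (rule has_sum_SigmaD[OF S])
      (auto intro!: has_sum_cmult_right has_sum_infsum abs_summable_summable[OF g])
  moreover have "((\<lambda>a. f a * infsum g B) has_sum infsum f A * infsum g B) A"
    by (intro has_sum_cmult_left has_sum_infsum abs_summable_summable[OF f])
  ultimately have "infsum (\<lambda>(a, b). f a * g b) (A \<times> B) = infsum f A * infsum g B"
    by (rule has_sum_unique)
  with S show ?thesis by (simp only:)
qed

text \<open>A two-sided series may be tested on its two halves; that both contain the index \<open>0\<close> does no harm
  to summability.\<close>

lemma abs_summable_on_int:
  fixes f :: "int \<Rightarrow> complex"
  assumes "summable (\<lambda>n. norm (f (int n)))" and "summable (\<lambda>n. norm (f (- int n)))"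
  shows "(\<lambda>k. norm (f k)) summable_on UNIV"
proof -
  have *: "(\<lambda>n. norm (f (s * int n))) summable_on UNIV" if "s = 1 \<or> s = -1" for s
    using assms that by (intro norm_summable_imp_summable_on) auto
  have img: "(\<lambda>k. norm (f k)) summable_on range (\<lambda>n. s * int n)" if "s = 1 \<or> s = -1" for s
    using *[OF that] that by (subst summable_on_reindex) (auto simp: inj_on_def o_def)
  have "(UNIV :: int set) = range (\<lambda>n. 1 * int n) \<union> range (\<lambda>n. -1 * int n)"
    by (auto simp: image_iff) (metis int_cases2)
  moreover have "(\<lambda>k. norm (f k)) summable_on \<dots>"
    by (intro summable_on_union img) auto
  ultimately show ?thesis by simp
qed

lemma int_triangular: "int (n * (n - 1) div 2) = int n * (int n - 1) div 2"
  by (cases n) (simp_all add: zdiv_int algebra_simps)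

text \<open>The half over negative indices has the same shape as the one over non-negative indices,
  with \<open>z\<close> replaced by \<open>q/z\<close>.\<close>

lemma abs_summable_theta:
  fixes q z :: complex
  assumes q: "q \<noteq> 0" "norm q < 1" and z: "z \<noteq> 0"
  shows "(\<lambda>m. norm (q powi (m * (m - 1) div 2) * z powi m)) summable_on UNIV"
proof (rule abs_summable_on_int)
  have tri': "(- int n) * (- int n - 1) div 2 = int (n * (n - 1) div 2) + int n" for n
  proof -
    have "(- int n) * (- int n - 1) = int n * (int n - 1) + int n * 2"
      by (simp add: algebra_simps)
    thus ?thesis unfolding int_triangular by simp
  qed
  have S: "summable (\<lambda>n. norm (q ^ (n * (n - 1) div 2) * w ^ n))" for w
  proof -
    have "qpoch 0 0 n = 1" for n by (simp add: qpoch_def)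
    thus ?thesis using summable_norm_Euler[of 0 q w] q by simp
  qed
  show "summable (\<lambda>n. norm (q powi (int n * (int n - 1) div 2) * z powi int n))"
    using S[of z] unfolding int_triangular [symmetric] power_int_of_nat .
  have "q powi (- int n * (- int n - 1) div 2) * z powi (- int n) =
      q ^ (n * (n - 1) div 2) * (q / z) ^ n" for n
    unfolding tri' using q z
    by (simp add: power_int_add power_int_minus power_mult_distrib power_inverse divide_inverse)
  thus "summable (\<lambda>n. norm (q powi (- int n * (- int n - 1) div 2) * z powi (- int n)))"
    using S[of "q / z"] by simp
qed

text \<open>On the left is the power of \<open>q\<close> in the product of the \<open>(k-n)\<close>-th term of \<open>\<theta>(y/q)\<close> and the
  \<open>n\<close>-th term of the q-Airy function. On the right the part depending on \<open>n\<close> has the quadratic term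
  \<open>n (n - 1)\<close>, which is the triangular exponent for the base \<open>q\<^sup>2\<close>: this doubling is why Euler's
  series appears with base \<open>q\<^sup>2\<close>.\<close>

lemma triangular_exponent:
  fixes k n :: int
  shows "(k - n) * (k - n - 1) div 2 + n * (n - 1) div 2 - (k - n) =
         k * (k - 1) div 2 - k + n * (n - 1) + (2 - k) * n"
proof -
  have even: "\<exists>a. i * (i - 1) = 2 * a" for i :: int
    by (rule evenE[of "i * (i - 1)"]) auto
  obtain a b c where abc: "(k - n) * (k - n - 1) = 2 * a" "n * (n - 1) = 2 * b" "k * (k - 1) = 2 * c"
    using even by meson
  have "a + b - (k - n) = c - k + 2 * b + (2 - k) * n"
    using abc by (simp add: algebra_simps)
  thus ?thesis
    unfolding abc by simp
qed

text \<open>The factor \<open>d\<close> stands for \<open>(q\<^sup>2; q\<^sup>2)\<^sub>n\<close>, which is common to both sides.\<close>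

lemma theta_Airy_term:
  fixes q y :: complex
  assumes q: "q \<noteq> 0" and y: "y \<noteq> 0"
  shows "q powi ((k - int n) * (k - int n - 1) div 2) * (y / q) powi (k - int n) *
           (q ^ (n * (n - 1) div 2) / d * (- y) ^ n) =
         q powi (k * (k - 1) div 2) * (y / q) powi k *
           ((q\<^sup>2) ^ (n * (n - 1) div 2) / d * (- (q powi (2 - k))) ^ n)"
proof -
  have even: "2 * (n * (n - 1) div 2) = n * (n - 1)"
    by (intro dvd_mult_div_cancel) auto
  have even': "int (n * (n - 1)) = int n * (int n - 1)"
    by (cases n) (simp_all add: algebra_simps)
  have "q powi ((k - int n) * (k - int n - 1) div 2) * (y / q) powi (k - int n) *
           (q ^ (n * (n - 1) div 2) / d * (- y) ^ n) =
        q powi ((k - int n) * (k - int n - 1) div 2 + int n * (int n - 1) div 2 - (k - int n)) *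
          y powi k * (- 1) ^ n / d"
    using q y unfolding power_int_of_nat [symmetric, of q] int_triangular
    by (simp add: power_int_divide_distrib power_int_add power_int_diff power_minus[of y])
  also have "\<dots> = q powi (k * (k - 1) div 2) * (y / q) powi k *
           (q powi (int (n * (n - 1))) / d * (- 1) ^ n * q powi ((2 - k) * int n))"
    using q y unfolding triangular_exponent even'
    by (simp add: power_int_divide_distrib power_int_add power_int_diff)
  also have "q powi (int (n * (n - 1))) = (q\<^sup>2) ^ (n * (n - 1) div 2)"
    by (simp only: power_int_of_nat power_mult [symmetric] even)
  also have "q powi ((2 - k) * int n) = (q powi (2 - k)) ^ n"
    by (simp only: power_int_power')
  finally show ?thesis
    by (simp add: power_minus[of "q powi (2 - k)"] mult_ac)
qed

text \<open>Summing the double series along the lines \<open>m + n = k\<close> turns each line into a multiple of Euler's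
  series at \<open>q\<^bsup>2-k\<^esup>\<close>.\<close>

lemma theta_times_Airy:
  fixes q y :: complex
  assumes q: "q \<noteq> 0" "norm q < 1" and y: "y \<noteq> 0"
  shows "((\<lambda>k. q powi (k * (k - 1) div 2) * (y / q) powi k *
                 qpoch_inf (q powi (2 - k)) (q\<^sup>2)) has_sum
           (jacobi_theta q (y / q) * q_Airy q (- y))) UNIV"
proof -
  have q2: "norm (q\<^sup>2) < 1"
    using q by (simp add: norm_power power_less_one_iff)
  define T where "T m = q powi (m * (m - 1) div 2) * (y / q) powi m" for m
  define A where "A n = q ^ (n * (n - 1) div 2) / qpoch (q\<^sup>2) (q\<^sup>2) n * (- y) ^ n" for n
  have T: "(\<lambda>m. norm (T m)) summable_on UNIV"
    unfolding T_def using abs_summable_theta[of q "y / q"] q y by simp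
  have A_norm: "summable (\<lambda>n. norm (A n))"
    unfolding A_def by (rule summable_norm_Euler[OF q2 q(2)])
  hence A: "(\<lambda>n. norm (A n)) summable_on UNIV"
    by (intro norm_summable_imp_summable_on) simp
  have "suminf A = q_Airy q (- y)"
    unfolding q_Airy_def A_def qpoch_minus_mult
    by (intro suminf_cong) (simp add: power_minus[of y])
  moreover have "infsum A UNIV = suminf A"
    by (rule infsumI[OF norm_summable_imp_has_sum[OF A_norm
          summable_sums[OF summable_norm_cancel[OF A_norm]]]])
  ultimately have "((\<lambda>(m, n). T m * A n) has_sum (jacobi_theta q (y / q) * q_Airy q (- y)))
      (UNIV \<times> UNIV)"
    using has_sum_product_abs[OF T A] by (simp add: jacobi_theta_def T_def)
  moreover have "((\<lambda>(k, n). T (k - int n) * A n) has_sum s) (UNIV \<times> UNIV) \<longleftrightarrow>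
      ((\<lambda>(m, n). T m * A n) has_sum s) (UNIV \<times> UNIV)" for s
    by (rule has_sum_reindex_bij_witness[of _ "\<lambda>(m, n). (m + int n, n)" "\<lambda>(k, n). (k - int n, n)"])
       auto
  ultimately have S: "((\<lambda>(k, n). T (k - int n) * A n) has_sum
      (jacobi_theta q (y / q) * q_Airy q (- y))) (UNIV \<times> UNIV)"
    by simp
  have row: "((\<lambda>n. T (k - int n) * A n) has_sum T k * qpoch_inf (q powi (2 - k)) (q\<^sup>2)) UNIV"
    for k
  proof -
    have "((\<lambda>n. (q\<^sup>2) ^ (n * (n - 1) div 2) / qpoch (q\<^sup>2) (q\<^sup>2) n * (- (q powi (2 - k))) ^ n)
        has_sum qpoch_inf (q powi (2 - k)) (q\<^sup>2)) UNIV"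
      by (intro norm_summable_imp_has_sum summable_norm_Euler[OF q2 q2] Euler_qpoch_inf(2)[OF q2])
    from has_sum_cmult_right[OF this, of "T k"] show ?thesis
      unfolding T_def A_def theta_Airy_term[OF q(1) y] .
  qed
  show ?thesis
    using has_sum_SigmaD[OF S, of "\<lambda>k. T k * qpoch_inf (q powi (2 - k)) (q\<^sup>2)"] row
    by (simp add: T_def)
qed


section \<open>The connection formula\<close>

theorem theorem1:
  fixes q x :: complex
  assumes "0 < norm q" and "norm q < 1" and "x \<noteq> 0"
  shows "ramanujan_A (q ^ 2) (- (q ^ 3 / x ^ 2)) =
           1 / (qpoch_inf q q * qpoch_inf (- 1) q) *
           (jacobi_theta q (x / q) * q_Airy q (- x) + jacobi_theta q (- (x / q)) * q_Airy q x)"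
proof -
  have q: "q \<noteq> 0" "norm q < 1" using assms by auto
  have q2: "norm (q\<^sup>2) < 1"
    using q by (simp add: norm_power power_less_one_iff)
  let ?S = "jacobi_theta q (x / q) * q_Airy q (- x) + jacobi_theta q (- (x / q)) * q_Airy q x"
  \<comment> \<open>The factor \<open>1 + (- 1) powi k\<close> comes from adding the expansions at \<open>x\<close> and at \<open>- x\<close>.\<close>
  define c where "c k = (1 + (- 1) powi k) * (q powi (k * (k - 1) div 2) * (x / q) powi k *
                 qpoch_inf (q powi (2 - k)) (q\<^sup>2))" for k
  have neg: "(- x / q) powi k = (- 1) powi k * (x / q) powi k" for k
    by (simp flip: power_int_mult_distrib)
  have sum_c: "(c has_sum ?S) UNIV"
    using has_sum_add[OF theta_times_Airy[OF q \<open>x \<noteq> 0\<close>] theta_times_Airy[OF q, of "- x"]] \<open>x \<noteq> 0\<close>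
    unfolding c_def neg by (simp add: algebra_simps)
  have c_0: "c k = 0" if "k \<notin> range (\<lambda>m::nat. - 2 * int m)" for k
  proof (cases "even k")
    case True
    then obtain j where j: "k = 2 * j" by blast
    have "j > 0"
    proof (rule ccontr)
      assume "\<not> j > 0"
      hence "k = - 2 * int (nat (- j))" using j by simp
      with that show False by blast
    qed
    hence "j = int (Suc (nat (j - 1)))"
      by simp
    then obtain i where i: "j = int (Suc i)" ..
    \<comment> \<open>So the factor with index \<open>i = j - 1\<close> of the product at \<open>q powi (2 - k)\<close> is zero.\<close>
    have "q powi (2 - k) * (q\<^sup>2) ^ i = q powi (2 - k) * q powi (2 * int i)"
      by (simp add: power_int_mult)
    also have "\<dots> = 1"
      using q by (simp add: j i flip: power_int_add)
    finally have "qpoch_inf (q powi (2 - k)) (q\<^sup>2) = 0"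
      by (rule qpoch_inf_eq_0)
    thus ?thesis by (simp add: c_def)
  qed (simp add: c_def power_int_minus_left)
  have "(c has_sum ?S) (range (\<lambda>m::nat. - 2 * int m)) \<longleftrightarrow> (c has_sum ?S) UNIV"
    by (rule has_sum_cong_neutral) (simp_all add: c_0)
  moreover have "inj (\<lambda>m::nat. - 2 * int m)"
    by (simp add: inj_on_def)
  ultimately have "((\<lambda>m. c (- 2 * int m)) has_sum ?S) UNIV"
    using sum_c by (simp only: has_sum_reindex o_def)
  hence sums_c: "(\<lambda>m. c (- 2 * int m)) sums ?S"
    by (rule has_sum_imp_sums)
  have coeff: "c (- 2 * int m) = 2 * qpoch_inf (q\<^sup>2) (q\<^sup>2) *
      ((q\<^sup>2) ^ (m\<^sup>2) / qpoch (q\<^sup>2) (q\<^sup>2) m * (q ^ 3 / x ^ 2) ^ m)" for m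
  proof -
    have tri: "(- 2 * int m) * (- 2 * int m - 1) div 2 = int (2 * m\<^sup>2 + m)"
    proof -
      have "(- 2 * int m) * (- 2 * int m - 1) = 2 * int (2 * m\<^sup>2 + m)"
        by (simp add: algebra_simps power2_eq_square)
      thus ?thesis by simp
    qed
    have sgn: "1 + (- 1) powi (- 2 * int m) = (2 :: complex)"
      by (simp add: power_int_minus_left)
    have "2 - (- 2 * int m) = int (2 * Suc m)"
      by simp
    hence fac: "qpoch_inf (q powi (2 - (- 2 * int m))) (q\<^sup>2) = qpoch_inf (q\<^sup>2) (q\<^sup>2) / qpoch (q\<^sup>2) (q\<^sup>2) m"
      by (simp only: power_int_of_nat power_mult qpoch_inf_power_Suc[OF q2])
    have arg: "(x / q) powi (- 2 * int m) = (q ^ 2 / x ^ 2) ^ m"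
    proof -
      have "(x / q) powi (- 2 * int m) = inverse ((x / q) ^ (2 * m))"
        using power_int_minus[of "x / q" "int (2 * m)"] by (simp only: power_int_of_nat) simp
      thus ?thesis by (simp add: power_mult power_divide)
    qed
    have exp: "q ^ (2 * m\<^sup>2 + m) * (q ^ 2 / x ^ 2) ^ m = (q\<^sup>2) ^ (m\<^sup>2) * (q ^ 3 / x ^ 2) ^ m"
    proof -
      have "q ^ (2 * m\<^sup>2 + m) * q ^ (2 * m) = q ^ (2 * m\<^sup>2) * q ^ (3 * m)"
        by (simp add: add.commute flip: power_add)
      thus ?thesis
        by (simp add: power_divide power_mult [symmetric])
    qed
    have "c (- 2 * int m) = 2 * (q ^ (2 * m\<^sup>2 + m) * (q ^ 2 / x ^ 2) ^ m *
        (qpoch_inf (q\<^sup>2) (q\<^sup>2) / qpoch (q\<^sup>2) (q\<^sup>2) m))"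
      unfolding c_def tri power_int_of_nat sgn fac arg ..
    thus ?thesis
      unfolding exp by simp
  qed
  have nz: "2 * qpoch_inf (q\<^sup>2) (q\<^sup>2) \<noteq> 0"
    using qpoch_inf_self_nonzero[OF q2] by simp
  have "(\<lambda>m. (q\<^sup>2) ^ (m\<^sup>2) / qpoch (q\<^sup>2) (q\<^sup>2) m * (q ^ 3 / x ^ 2) ^ m)
      sums (?S / (2 * qpoch_inf (q\<^sup>2) (q\<^sup>2)))"
    using sums_divide[OF sums_c, of "2 * qpoch_inf (q\<^sup>2) (q\<^sup>2)"]
    unfolding coeff nonzero_mult_div_cancel_left[OF nz] .
  hence "ramanujan_A (q ^ 2) (- (q ^ 3 / x ^ 2)) = ?S / (2 * qpoch_inf (q\<^sup>2) (q\<^sup>2))"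
    unfolding ramanujan_A_def minus_minus by (rule sums_unique [symmetric])
  thus ?thesis
    unfolding qpoch_inf_q_minus_one[OF q(2)] by (simp only: times_divide_eq_left mult_1_left)
qed

end
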